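(* Let $M$ be a free $\mathbb{Z}$-module of finite rank $m$ with free basis $x_1,\ldots,x_m$, and let $n$ be a positive integer. Let $\mathsf{P}_n(M)$ be the $\mathbb{Z}$-submodule of $\mathsf{T}^n(M)=M^{\otimes n}$ generated by the set $\{\underbrace{x\otimes\cdots\otimes x}_{n}\mid x\in M\}$. Then $\mathsf{P}_n(M)$ is generated, as a $\mathbb{Z}$-module, by the set of elements of $\mathsf{T}^n(M)$ of the form $$\sum_{\substack{k_1,\ldots,k_s>0\\ k_1+\cdots+k_s=n}}(x_{j_1}^{(k_1)}\cdots x_{j_s}^{(k_s)})^\ast$$ for all integers $s$ with $1\le s\le n$ and all indices $1\le j_1\le\cdots\le j_s\le m$ (repetitions among the $j_r$ are allowed).
   Context: $\mathsf{T}(M)=\bigoplus_{n\ge 0}\mathsf{T}^n(M)$ denotes the tensor algebra of the $\mathbb{Z}$-module $M$, with $\mathsf{T}^n(M)=M^{\otimes n}$ (tensor products over $\mathbb{Z}$). Modified symmetrizations: let $X_1,\ldots,X_s$ be distinct non-commuting indeterminates over $\mathbb{Z}$ and let $k_1,\ldots,k_s$ be positive integers with $k_1+\cdots+k_s=n$. Then $(X_1^{(k_1)}\cdots X_s^{(k_s)})^\ast$ denotes the sum of all distinct non-commutative monomials obtained from $X_1^{k_1}\cdots X_s^{k_s}$ by permuting its $n$ factors, that is, the sum of the $\frac{n!}{k_1!\cdots k_s!}$ words of length $n$ in which $X_r$ occurs exactly $k_r$ times for each $r=1,\ldots,s$. For elements $y_1,\ldots,y_s$ of $M$, not necessarily distinct,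 $(y_1^{(k_1)}\cdots y_s^{(k_s)})^\ast\in\mathsf{T}^n(M)$ denotes the result of substituting $y_r$ for $X_r$ in this polynomial, the product being the tensor product in $\mathsf{T}(M)$. The sum in the claim runs over all ordered $s$-tuples $(k_1,\ldots,k_s)$ of positive integers with sum $n$. *)

theory Defs
  imports "HOL-Library.Poly_Mapping" "HOL-Combinatorics.Multiset_Permutations"
begin

section \<open>Abelian groups as modules over the integers\<close>

definition zscale :: "int \<Rightarrow> 'a::ab_group_add \<Rightarrow> 'a" where
  "zscale k a = (if 0 \<le> k then (\<Sum>i<nat k. a) else - (\<Sum>i<nat (- k). a))"

lemma zscale_zero [simp]: "zscale 0 a = 0"
  by (simp add: zscale_def)

lemma zscale_one [simp]: "zscale 1 a = a"
  by (simp add: zscale_def)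

lemma zscale_Suc: "zscale (1 + int n) a = a + zscale (int n) a"
proof -
  have "nat (1 + int n) = Suc n" by simp
  then show ?thesis by (simp add: zscale_def add.commute)
qed

lemma zscale_minus: "zscale (- k) a = - zscale k a"
  by (cases "k = 0") (simp_all add: zscale_def)

lemma zscale_add_one: "zscale (k + 1) a = zscale k a + a"
proof (cases k rule: int_cases)
  case (nonneg n)
  then show ?thesis using zscale_Suc[of n a] by (simp add: add.commute)
next
  case (neg n)
  have "zscale (k + 1) a = - zscale (int n) a"
    using neg zscale_minus[of "int n" a] by simp
  moreover have "zscale k a = - zscale (1 + int n) a"
    using neg zscale_minus[of "1 + int n" a] by simp
  ultimately show ?thesis by (simp add: zscale_Suc)
qed

lemma zscale_left_distrib: "zscale (k + l) a = zscale k a + zscale l a"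
proof (induction l rule: int_induct[where k = 0])
  case base
  show ?case by simp
next
  case (step1 i)
  then show ?case using zscale_add_one[of "k + i" a] zscale_add_one[of i a]
    by (simp add: add.assoc)
next
  case (step2 i)
  then show ?case using zscale_add_one[of "k + (i - 1)" a] zscale_add_one[of "i - 1" a]
    by (simp add: algebra_simps)
qed

lemma zscale_right_distrib: "zscale k (a + b) = zscale k a + zscale k b"
  by (simp add: zscale_def sum.distrib)

lemma zscale_zscale: "zscale k (zscale l a) = zscale (k * l) a"
proof (induction k rule: int_induct[where k = 0])
  case base
  show ?case by simp
next
  case (step1 i)
  then show ?case
    by (simp add: zscale_add_one distrib_right zscale_left_distrib)
next
  case (step2 i)
  have "zscale (i - 1) (zscale l a) = zscale i (zscale l a) - zscale l a"
    using zscale_add_one[of "i - 1" "zscale l a"] by (simp add: algebra_simps)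
  moreover have "zscale (i * l) a = zscale ((i - 1) * l) a + zscale l a"
    using zscale_left_distrib[of "(i - 1) * l" l a] by (simp add: algebra_simps)
  ultimately show ?case using step2 by simp
qed

interpretation zmod: module zscale
  by standard
    (rule zscale_right_distrib zscale_left_distrib zscale_zscale zscale_one)+

text \<open>An abelian group carries exactly one module structure over the integers, so taking
  \<^const>\<open>zscale\<close> as the scalar multiplication loses no generality.\<close>

lemma int_module_unique:
  fixes s :: "int \<Rightarrow> 'a::ab_group_add \<Rightarrow> 'a"
  assumes "module s"
  shows "s = zscale"
proof (intro ext)
  fix k a
  interpret s: module s by fact
  show "s k a = zscale k a"
    by (induction k rule: int_induct[where k = 0])
       (simp_all add: s.scale_left_distrib zscale_add_one s.scale_left_diff_distrib
         zmod.scale_left_diff_distrib zmod.scale_one)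
qed

lemma zscale_conv_mult: "zscale k (t :: 'a::ring_1) = of_int k * t"
proof -
  have "module (\<lambda>k (t::'a). of_int k * t)"
    by standard (simp_all add: algebra_simps)
  then show ?thesis using int_module_unique by metis
qed


section \<open>Non-commutative polynomials with integer coefficients\<close>

datatype 'a free_monoid = Word (letters: "'a list")

instantiation free_monoid :: (type) monoid_add
begin

definition "0 = Word []"
definition "u + v = Word (letters u @ letters v)"

instance
  by standard (simp_all add: zero_free_monoid_def plus_free_monoid_def)

end

text \<open>Finitely supported integer functions on the free monoid; by the general instance for
  \<^type>\<open>poly_mapping\<close> the product is the bilinear extension of concatenation of words.\<close>

type_synonym 'a ncpoly = "'a free_monoid \<Rightarrow>\<^sub>0 int"

definition nc_word :: "'a list \<Rightarrow> 'a ncpoly" where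
  "nc_word w = Poly_Mapping.single (Word w) 1"

definition nc_var :: "'a \<Rightarrow> 'a ncpoly" where
  "nc_var a = nc_word [a]"

definition nc_subst :: "('a \<Rightarrow> 'r::ring_1) \<Rightarrow> 'a ncpoly \<Rightarrow> 'r" where
  "nc_subst y p =
     (\<Sum>w\<in>Poly_Mapping.keys p. of_int (Poly_Mapping.lookup p w) * prod_list (map y (letters w)))"

lemma nc_word_Nil: "nc_word [] = 1"
  by (simp add: nc_word_def flip: zero_free_monoid_def)

lemma nc_word_append: "nc_word (u @ v) = nc_word u * nc_word v"
  by (simp add: nc_word_def mult_single plus_free_monoid_def)

lemma nc_word_conv_prod_list: "nc_word w = prod_list (map nc_var w)"
proof (induction w)
  case Nil
  show ?case by (simp add: nc_word_Nil)
next
  case (Cons a w)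
  then show ?case using nc_word_append[of "[a]" w] by (simp add: nc_var_def)
qed

lemma nc_subst_superset:
  assumes "finite A" "Poly_Mapping.keys p \<subseteq> A"
  shows "nc_subst y p =
     (\<Sum>w\<in>A. of_int (Poly_Mapping.lookup p w) * prod_list (map y (letters w)))"
  unfolding nc_subst_def
  by (rule sum.mono_neutral_left) (use assms in \<open>auto simp: in_keys_iff\<close>)

lemma nc_subst_add: "nc_subst y (p + q) = nc_subst y p + nc_subst y q"
proof -
  let ?A = "Poly_Mapping.keys p \<union> Poly_Mapping.keys q"
  have "Poly_Mapping.keys (p + q) \<subseteq> ?A" by (rule Poly_Mapping.keys_add)
  then show ?thesis
    by (simp add: nc_subst_superset[of ?A] lookup_add distrib_right sum.distrib)
qed

lemma nc_subst_zero: "nc_subst y 0 = 0"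
  by (simp add: nc_subst_def)

lemma nc_subst_sum: "nc_subst y (sum f A) = (\<Sum>a\<in>A. nc_subst y (f a))"
  by (induction A rule: infinite_finite_induct) (simp_all add: nc_subst_zero nc_subst_add)

lemma nc_subst_word: "nc_subst y (nc_word w) = prod_list (map y w)"
  by (simp add: nc_subst_def nc_word_def)


section \<open>The tensor algebra\<close>

text \<open>The tensor algebra of the integral module \<open>'a\<close> is the ring of non-commutative polynomials
  in indeterminates indexed by the elements of \<open>'a\<close>, modulo the two-sided ideal making the
  indeterminates additive in their index. Additivity already implies
  linearity over the integers.\<close>

definition tensor_ideal :: "'a::ab_group_add ncpoly set" where
  "tensor_ideal = zmod.span {p * (nc_var (a + b) - nc_var a - nc_var b) * q | p a b q. True}"

lemma tensor_ideal_mult_left: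
  assumes "t \<in> tensor_ideal"
  shows "p * t \<in> tensor_ideal"
  using assms unfolding tensor_ideal_def
proof (induction rule: zmod.span_induct_alt)
  case base
  show ?case by (simp add: zmod.span_zero)
next
  case (step c x y)
  then obtain p' a b q where "x = p' * (nc_var (a + b) - nc_var a - nc_var b) * q" by blast
  then have "p * x = (p * p') * (nc_var (a + b) - nc_var a - nc_var b) * q"
    by (simp only: mult.assoc)
  then have "p * x \<in> zmod.span {p * (nc_var (a + b) - nc_var a - nc_var b) * q | p a b q. True}"
    by (intro zmod.span_base) blast
  moreover have "p * zscale c x = zscale c (p * x)"
    by (simp add: zscale_conv_mult mult.assoc flip: mult.assoc mult_of_int_commute)
  ultimately show ?case using step
    by (simp add: distrib_left zmod.span_add zmod.span_scale)
qed

lemma tensor_ideal_mult_right: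
  assumes "t \<in> tensor_ideal"
  shows "t * p \<in> tensor_ideal"
  using assms unfolding tensor_ideal_def
proof (induction rule: zmod.span_induct_alt)
  case base
  show ?case by (simp add: zmod.span_zero)
next
  case (step c x y)
  then obtain p' a b q where "x = p' * (nc_var (a + b) - nc_var a - nc_var b) * q" by blast
  then have "x * p = p' * (nc_var (a + b) - nc_var a - nc_var b) * (q * p)"
    by (simp only: mult.assoc)
  then have "x * p \<in> zmod.span {p * (nc_var (a + b) - nc_var a - nc_var b) * q | p a b q. True}"
    by (intro zmod.span_base) blast
  moreover have "zscale c x * p = zscale c (x * p)"
    by (simp add: zscale_conv_mult mult.assoc)
  ultimately show ?case using step
    by (simp add: distrib_right zmod.span_add zmod.span_scale)
qed

definition tensor_rel :: "'a::ab_group_add ncpoly \<Rightarrow> 'a ncpoly \<Rightarrow> bool" where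
  "tensor_rel p q \<longleftrightarrow> p - q \<in> tensor_ideal"

lemma tensor_ideal_zero: "0 \<in> tensor_ideal"
  and tensor_ideal_add: "p \<in> tensor_ideal \<Longrightarrow> q \<in> tensor_ideal \<Longrightarrow> p + q \<in> tensor_ideal"
  and tensor_ideal_minus: "p \<in> tensor_ideal \<Longrightarrow> - p \<in> tensor_ideal"
  by (simp_all add: tensor_ideal_def zmod.span_zero zmod.span_add zmod.span_neg)

lemma equivp_tensor_rel: "equivp tensor_rel"
proof (rule equivpI)
  show "reflp tensor_rel"
    by (simp add: reflp_def tensor_rel_def tensor_ideal_zero)
  show "symp tensor_rel"
    unfolding symp_def tensor_rel_def by (metis minus_diff_eq tensor_ideal_minus)
  show "transp tensor_rel"
  proof (rule transpI)
    fix p q r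
    assume "tensor_rel p q" "tensor_rel q r"
    then have "(p - q) + (q - r) \<in> tensor_ideal"
      unfolding tensor_rel_def by (rule tensor_ideal_add)
    then show "tensor_rel p r" by (simp add: tensor_rel_def)
  qed
qed

definition word_extend :: "('a list \<Rightarrow> 'b::ab_group_add) \<Rightarrow> 'a ncpoly \<Rightarrow> 'b" where
  "word_extend f p =
     (\<Sum>w\<in>Poly_Mapping.keys p. zscale (Poly_Mapping.lookup p w) (f (letters w)))"

lemma word_extend_superset:
  assumes "finite A" "Poly_Mapping.keys p \<subseteq> A"
  shows "word_extend f p = (\<Sum>w\<in>A. zscale (Poly_Mapping.lookup p w) (f (letters w)))"
  unfolding word_extend_def
  by (rule sum.mono_neutral_left) (use assms in \<open>auto simp: in_keys_iff\<close>)

lemma word_extend_add: "word_extend f (p + q) = word_extend f p + word_extend f q"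
proof -
  let ?A = "Poly_Mapping.keys p \<union> Poly_Mapping.keys q"
  have "Poly_Mapping.keys (p + q) \<subseteq> ?A" by (rule Poly_Mapping.keys_add)
  then show ?thesis
    by (simp add: word_extend_superset[of ?A] lookup_add zmod.scale_left_distrib sum.distrib)
qed

lemma word_extend_word: "word_extend f (nc_word u) = f u"
  by (simp add: word_extend_def nc_word_def)

lemma word_extend_tensor_ideal:
  fixes f :: "'a::ab_group_add list \<Rightarrow> 'b::ab_group_add"
  assumes f: "\<And>u a b v. f (u @ [a + b] @ v) = f (u @ [a] @ v) + f (u @ [b] @ v)"
    and p: "p \<in> tensor_ideal"
  shows "word_extend f p = 0"
proof -
  interpret H: Modules.additive "word_extend f" by standard (rule word_extend_add)
  have H_scale: "word_extend f (zscale k p) = zscale k (word_extend f p)" for k p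
    by (simp add: zscale_def H.minus H.sum del: sum_constant)
  have H_rel: "word_extend f (p * (nc_var (a + b) - nc_var a - nc_var b) * q) = 0" for p a b q
  proof (rule frag_induction[of p UNIV])
    fix w :: "'a free_monoid"
    show "word_extend f (frag_of w * (nc_var (a + b) - nc_var a - nc_var b) * q) = 0"
    proof (rule frag_induction[of q UNIV])
      fix w' :: "'a free_monoid"
      have eq: "frag_of w = nc_word (letters w)" "frag_of w' = nc_word (letters w')"
        by (simp_all add: nc_word_def)
      show "word_extend f (frag_of w * (nc_var (a + b) - nc_var a - nc_var b) * frag_of w') = 0"
        unfolding eq nc_var_def right_diff_distrib left_diff_distrib H.diff
        unfolding nc_word_append[symmetric] word_extend_word append_assoc f by simp
    qed (simp_all add: H.zero H.diff right_diff_distrib)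
  qed (simp_all add: H.zero H.diff left_diff_distrib)
  show ?thesis
    using p unfolding tensor_ideal_def
    by (induction rule: zmod.span_induct_alt)
       (auto simp: H.zero word_extend_add H_scale H_rel)
qed

lemma one_notin_tensor_ideal: "1 \<notin> tensor_ideal"
proof
  assume "(1 :: 'a ncpoly) \<in> tensor_ideal"
  then have "word_extend (\<lambda>u. if u = [] then 1 else 0 :: int) (1 :: 'a ncpoly) = 0"
    by (rule word_extend_tensor_ideal[rotated]) simp
  then show False by (simp add: word_extend_word flip: nc_word_Nil)
qed

quotient_type (overloaded) 'a tensor_algebra = "'a::ab_group_add ncpoly" / tensor_rel
  by (rule equivp_tensor_rel)

instantiation tensor_algebra :: (ab_group_add) ring_1
begin

lift_definition zero_tensor_algebra :: "'a tensor_algebra" is 0 .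

lift_definition one_tensor_algebra :: "'a tensor_algebra" is 1 .

lift_definition plus_tensor_algebra ::
  "'a tensor_algebra \<Rightarrow> 'a tensor_algebra \<Rightarrow> 'a tensor_algebra" is "(+)"
  unfolding tensor_rel_def by (metis add_diff_add tensor_ideal_add)

lift_definition uminus_tensor_algebra :: "'a tensor_algebra \<Rightarrow> 'a tensor_algebra" is uminus
  unfolding tensor_rel_def by (metis minus_diff_minus tensor_ideal_minus)

lift_definition minus_tensor_algebra ::
  "'a tensor_algebra \<Rightarrow> 'a tensor_algebra \<Rightarrow> 'a tensor_algebra" is "(-)"
proof -
  fix p p' q q' :: "'a ncpoly"
  assume "tensor_rel p p'" "tensor_rel q q'"
  then have "(p - p') + - (q - q') \<in> tensor_ideal"
    unfolding tensor_rel_def by (intro tensor_ideal_add tensor_ideal_minus)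
  then show "tensor_rel (p - q) (p' - q')"
    by (simp add: tensor_rel_def algebra_simps)
qed

lift_definition times_tensor_algebra ::
  "'a tensor_algebra \<Rightarrow> 'a tensor_algebra \<Rightarrow> 'a tensor_algebra" is "(*)"
proof -
  fix p p' q q' :: "'a ncpoly"
  assume "tensor_rel p p'" "tensor_rel q q'"
  then have "(p - p') * q + p' * (q - q') \<in> tensor_ideal"
    unfolding tensor_rel_def
    by (intro tensor_ideal_add tensor_ideal_mult_left tensor_ideal_mult_right)
  then show "tensor_rel (p * q) (p' * q')"
    by (simp add: tensor_rel_def algebra_simps)
qed

instance
proof
  fix a b c :: "'a tensor_algebra"
  have refl: "tensor_rel p p" for p :: "'a ncpoly"
    by (simp add: tensor_rel_def tensor_ideal_zero)
  show "a + b + c = a + (b + c)" by transfer (simp add: add.assoc refl)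
  show "a + b = b + a" by transfer (simp add: add.commute refl)
  show "0 + a = a" by transfer (simp add: refl)
  show "- a + a = 0" by transfer (simp add: refl)
  show "a - b = a + - b" by transfer (simp add: refl)
  show "a * b * c = a * (b * c)" by transfer (simp add: mult.assoc refl)
  show "1 * a = a" by transfer (simp add: refl)
  show "a * 1 = a" by transfer (simp add: refl)
  show "(a + b) * c = a * c + b * c" by transfer (simp add: distrib_right refl)
  show "a * (b + c) = a * b + a * c" by transfer (simp add: distrib_left refl)
  show "(0 :: 'a tensor_algebra) \<noteq> 1"
    using one_notin_tensor_ideal[where 'a = 'a] tensor_ideal_minus[of "- 1 :: 'a ncpoly"]
    by transfer (auto simp: tensor_rel_def)
qed

end

text \<open>The canonical map from the module into degree one. The product of the tensor algebra is
  the tensor product, so \<open>tensor_in y\<^sub>1 * \<dots> * tensor_in y\<^sub>n\<close> is the pure tensor of the \<open>y\<^sub>i\<close>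
  and \<open>tensor_in y ^ n\<close> is the \<open>n\<close>-fold tensor power of \<open>y\<close>.\<close>

lift_definition tensor_in :: "'a::ab_group_add \<Rightarrow> 'a tensor_algebra" is nc_var .

definition pure_tensor :: "'a::ab_group_add list \<Rightarrow> 'a tensor_algebra" where
  "pure_tensor ys = prod_list (map tensor_in ys)"

definition tensor_power :: "nat \<Rightarrow> 'a::ab_group_add tensor_algebra set" where
  "tensor_power n = zmod.span {pure_tensor ys | ys. length ys = n}"

lemma tensor_in_add: "tensor_in (a + b) = tensor_in a + tensor_in b"
proof (transfer, unfold tensor_rel_def)
  fix a b :: 'a
  have "1 * (nc_var (a + b) - nc_var a - nc_var b) * 1 \<in> tensor_ideal"
    unfolding tensor_ideal_def by (intro zmod.span_base) blast
  then show "nc_var (a + b) - (nc_var a + nc_var b) \<in> tensor_ideal"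
    by (simp add: algebra_simps)
qed

lemma pure_tensor_Nil: "pure_tensor [] = 1"
  and pure_tensor_append: "pure_tensor (u @ v) = pure_tensor u * pure_tensor v"
  and pure_tensor_single: "pure_tensor [a] = tensor_in a"
  by (simp_all add: pure_tensor_def)

lemma pure_tensor_add:
  "pure_tensor (u @ [a + b] @ v) = pure_tensor (u @ [a] @ v) + pure_tensor (u @ [b] @ v)"
  by (simp only: pure_tensor_append pure_tensor_single tensor_in_add distrib_left distrib_right)

lemma pure_tensor_conv_abs: "pure_tensor u = abs_tensor_algebra (nc_word u)"
proof (induction u)
  case Nil
  show ?case by (simp add: pure_tensor_Nil nc_word_Nil one_tensor_algebra_def)
next
  case (Cons a u)
  have "pure_tensor (a # u) = tensor_in a * pure_tensor u" by (simp add: pure_tensor_def)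
  also have "\<dots> = abs_tensor_algebra (nc_var a * nc_word u)"
    by (simp add: Cons tensor_in.abs_eq times_tensor_algebra.abs_eq)
  also have "nc_var a * nc_word u = nc_word (a # u)"
    using nc_word_append[of "[a]" u] by (simp add: nc_var_def)
  finally show ?case .
qed

lemma tensor_algebra_induct [case_names pure diff]:
  assumes pure: "\<And>u. P (pure_tensor u)"
    and diff: "\<And>s t. P s \<Longrightarrow> P t \<Longrightarrow> P (s - t)"
  shows "P t"
proof -
  have "P (abs_tensor_algebra p)" for p
  proof (rule frag_induction[of p UNIV "\<lambda>p. P (abs_tensor_algebra p)"])
    show "P (abs_tensor_algebra 0)"
      using diff[OF pure pure] by (metis diff_self zero_tensor_algebra_def)
    show "P (abs_tensor_algebra (frag_of w))" for w
      using pure[of "letters w"] by (simp add: pure_tensor_conv_abs nc_word_def)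
    show "P (abs_tensor_algebra (p - q))"
      if "P (abs_tensor_algebra p)" "P (abs_tensor_algebra q)" for p q
      using diff[OF that] by (simp add: minus_tensor_algebra.abs_eq)
  qed simp
  then show ?thesis by (metis Quotient_tensor_algebra Quotient_abs_rep)
qed

text \<open>Universal property: a family of maps, one for each \<open>n\<close>, on \<open>n\<close>-tuples that is additive
  in every argument factors uniquely through the pure tensors. Choosing such a family to vanish
  outside length \<open>n\<close> shows that \<^term>\<open>tensor_power n\<close> is the \<open>n\<close>-th tensor power of the module
  and that the tensor algebra is the direct sum of its tensor powers.\<close>

lemma tensor_algebra_universal:
  fixes f :: "'a::ab_group_add list \<Rightarrow> 'b::ab_group_add"
  assumes f: "\<And>u a b v. f (u @ [a + b] @ v) = f (u @ [a] @ v) + f (u @ [b] @ v)"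
  shows "\<exists>!h. Modules.additive h \<and> (\<forall>u. h (pure_tensor u) = f u)"
proof -
  let ?H = "word_extend f"
  interpret H: Modules.additive ?H by standard (rule word_extend_add)
  define h where "h t = ?H (rep_tensor_algebra t)" for t
  have h_abs: "h (abs_tensor_algebra p) = ?H p" for p
  proof -
    have "tensor_rel (rep_tensor_algebra (abs_tensor_algebra p)) p"
      using Quotient_tensor_algebra equivp_tensor_rel
      by (metis Quotient_rep_abs equivp_reflp)
    then show ?thesis
      using word_extend_tensor_ideal[of f "rep_tensor_algebra (abs_tensor_algebra p) - p", OF f]
      by (simp add: tensor_rel_def h_def H.diff)
  qed
  have abs: "abs_tensor_algebra (rep_tensor_algebra t) = t" for t :: "'a tensor_algebra"
    by (rule Quotient_abs_rep[OF Quotient_tensor_algebra])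
  show ?thesis
  proof (rule ex1I[of _ h])
    have "h (s + t) = h s + h t" for s t
      using h_abs[of "rep_tensor_algebra s + rep_tensor_algebra t"]
      by (simp add: abs word_extend_add h_def flip: plus_tensor_algebra.abs_eq)
    then show "Modules.additive h \<and> (\<forall>u. h (pure_tensor u) = f u)"
      by (simp add: additive_def pure_tensor_conv_abs h_abs word_extend_word)
  next
    fix g assume g: "Modules.additive g \<and> (\<forall>u. g (pure_tensor u) = f u)"
    interpret g: Modules.additive g using g by simp
    have "Modules.additive h"
    proof
      show "h (s + t) = h s + h t" for s t
        using h_abs[of "rep_tensor_algebra s + rep_tensor_algebra t"]
        by (simp add: abs word_extend_add h_def flip: plus_tensor_algebra.abs_eq)
    qed
    then interpret h: Modules.additive h .
    have "g t = h t" for t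
      by (induction t rule: tensor_algebra_induct)
         (use g in \<open>simp_all add: g.diff h.diff pure_tensor_conv_abs h_abs word_extend_word\<close>)
    then show "g = h" by blast
  qed
qed


section \<open>Powers and modified symmetrizations\<close>

definition power_submodule :: "nat \<Rightarrow> 'a::ab_group_add tensor_algebra set" where
  "power_submodule n = zmod.span {tensor_in y ^ n | y. True}"

text \<open>For exponents \<open>ks = [k\<^sub>1, \<dots>, k\<^sub>s]\<close> the indeterminates \<open>X\<^sub>1, \<dots>, X\<^sub>s\<close> are numbered
  \<open>0, \<dots>, s - 1\<close>, matching list positions.\<close>

definition sym_poly :: "nat list \<Rightarrow> nat ncpoly" where
  "sym_poly ks =
     (\<Sum>w\<in>permutations_of_multiset (\<Sum>r<length ks. replicate_mset (ks ! r) r). nc_word w)"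

definition sym_tensor :: "'a::ab_group_add list \<Rightarrow> nat list \<Rightarrow> 'a tensor_algebra" where
  "sym_tensor ys ks = nc_subst (\<lambda>r. tensor_in (ys ! r)) (sym_poly ks)"

definition compositions :: "nat \<Rightarrow> nat \<Rightarrow> nat list set" where
  "compositions s n = {ks. length ks = s \<and> (\<forall>k\<in>set ks. 0 < k) \<and> sum_list ks = n}"

lemma finite_compositions: "finite (compositions s n)"
proof (rule finite_subset)
  show "compositions s n \<subseteq> {ks. set ks \<subseteq> {..n} \<and> length ks = s}"
    using member_le_sum_list by (fastforce simp: compositions_def)
qed (rule finite_lists_length_eq, simp)

lemma power_submodule_subset: "power_submodule n \<subseteq> tensor_power n"
  unfolding power_submodule_def tensor_power_def
proof (rule zmod.span_mono, clarify)
  fix y :: 'a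
  have "tensor_in y ^ n = pure_tensor (replicate n y)"
    by (simp add: pure_tensor_def prod_list_replicate)
  then show "\<exists>ys. tensor_in y ^ n = pure_tensor ys \<and> length ys = n"
    by (metis length_replicate)
qed

lemma sym_tensor_eq:
  "sym_tensor ys ks =
     (\<Sum>w\<in>permutations_of_multiset (\<Sum>r<length ks. replicate_mset (ks ! r) r).
        pure_tensor (map ((!) ys) w))"
  by (simp add: sym_tensor_def sym_poly_def nc_subst_sum nc_subst_word pure_tensor_def comp_def)

lemma sym_tensor_in_tensor_power: "sym_tensor ys ks \<in> tensor_power (sum_list ks)"
  unfolding sym_tensor_eq tensor_power_def
proof (intro zmod.span_sum zmod.span_base)
  fix w assume "w \<in> permutations_of_multiset (\<Sum>r<length ks. replicate_mset (ks ! r) r)"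
  then have "length w = size (\<Sum>r<length ks. replicate_mset (ks ! r) r)"
    by (metis permutations_of_multisetD size_mset)
  also have "\<dots> = sum_list ks"
    by (simp add: size_multiset_sum sum_list_sum_nth atLeast0LessThan)
  finally show "pure_tensor (map ((!) ys) w) \<in> {pure_tensor ys | ys. length ys = sum_list ks}"
    by force
qed

end

theory Submission
  imports Defs
begin

text \<open>Let \<open>E(y\<^sub>1, \<dots>, y\<^sub>s)\<close> be the sum of the tensors \<open>y\<^bsub>w 1\<^esub> \<otimes> \<dots> \<otimes> y\<^bsub>w n\<^esub>\<close> over all surjections
  \<open>w : {1, \<dots>, n} \<rightarrow> {1, \<dots>, s}\<close>. Sorting the words \<open>w\<close> by the number of occurrences of each letter shows that
  \<open>E(x\<^bsub>j 1\<^esub>, \<dots>, x\<^bsub>j s\<^esub>)\<close> is the generator of the claim, and sorting all words by their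
  support gives \<open>(y\<^sub>1 + \<dots> + y\<^sub>N)\<^sup>n = \<Sum>\<^sub>T E(y\<^sub>T)\<close> over the subsets \<open>T\<close> of \<open>{1, \<dots>, N}\<close>, where
  only \<open>1 \<le> card T \<le> n\<close> contributes. Inversion over the subset lattice puts the generators into
  \<open>P\<^sub>n(M)\<close>, and the formula itself puts the powers of nonnegative combinations of the basis into the
  span of the generators. As finite differences of order \<open>n + 1\<close> of \<open>y \<mapsto> y\<^sup>n\<close> vanish, \<open>y\<^sup>n\<close> is an
  integral combination of \<open>(y + k x\<^sub>j)\<^sup>n\<close> with \<open>1 \<le> k \<le> n + 1\<close>, which removes
  negative coefficients one unit at a time.\<close>

section \<open>Powers of sums, expanded into words and sorted by support\<close>

lemma power_sum_eq_sum_words: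
  fixes z :: "'i \<Rightarrow> 'r::ring_1"
  assumes "finite I"
  shows "(\<Sum>i\<in>I. z i) ^ n = (\<Sum>w | set w \<subseteq> I \<and> length w = n. prod_list (map z w))"
proof (induction n)
  case 0
  have "{w. set w \<subseteq> I \<and> length w = 0} = {[]}" by auto
  then show ?case by simp
next
  case (Suc n)
  let ?W = "{w. set w \<subseteq> I \<and> length w = n}"
  have "(\<Sum>w | set w \<subseteq> I \<and> length w = Suc n. prod_list (map z w)) =
      (\<Sum>(w, i)\<in>?W \<times> I. prod_list (map z (i # w)))"
    unfolding lists_length_Suc_eq
    by (subst sum.reindex) (auto simp: inj_on_def intro!: sum.cong)
  also have "\<dots> = (\<Sum>w\<in>?W. \<Sum>i\<in>I. prod_list (map z (i # w)))"
    by (rule sum.cartesian_product[symmetric])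
  also have "\<dots> = (\<Sum>i\<in>I. z i) * (\<Sum>w\<in>?W. prod_list (map z w))"
    by (simp add: sum_product sum.swap[of _ I])
  finally show ?case by (simp add: Suc)
qed

text \<open>Letters of \<open>J\<close> occur freely, each letter of \<open>T\<close> must occur,
  and no others may. \<open>J = {}\<close> gives the words onto \<open>T\<close>;
  \<open>J = {0}\<close> serves the finite differences, with the letter 0 carrying the base
  point.\<close>

definition words_over :: "nat \<Rightarrow> 'i set \<Rightarrow> 'i set \<Rightarrow> 'i list set" where
  "words_over n J T = {w. length w = n \<and> set w - J = T}"

definition support_sum :: "nat \<Rightarrow> ('i \<Rightarrow> 'r::ring_1) \<Rightarrow> 'i set \<Rightarrow> 'i set \<Rightarrow> 'r" where
  "support_sum n z J T = (\<Sum>w\<in>words_over n J T. prod_list (map z w))"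

text \<open>A word of length \<open>n\<close> has at most \<open>n\<close> distinct letters. Through
  \<open>support_sum_eq_alternating\<close> this becomes the vanishing of differences of order above
  \<open>n\<close>.\<close>

lemma support_sum_eq_0:
  assumes "finite J" "n < card T"
  shows "support_sum n z J T = 0"
proof -
  have "card (set w - J) \<le> length w" for w
    by (meson card_length card_mono Diff_subset finite_set le_trans)
  then have "words_over n J T = {}"
    using assms(2) by (auto simp: words_over_def not_le[symmetric])
  then show ?thesis by (simp add: support_sum_def)
qed

lemma support_sum_empty_eq_0: "0 < n \<Longrightarrow> support_sum n z {} {} = 0"
  unfolding support_sum_def words_over_def by (rule sum.neutral) auto

lemma power_sum_eq_support_sums:
  fixes z :: "'i \<Rightarrow> 'r::ring_1"
  assumes "finite J" "finite S"
  shows "(\<Sum>i\<in>J \<union> S. z i) ^ n = (\<Sum>T\<in>Pow S. support_sum n z J T)"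
proof -
  let ?W = "{w. set w \<subseteq> J \<union> S \<and> length w = n}"
  have "(\<Sum>T\<in>Pow S. support_sum n z J T) =
      (\<Sum>T\<in>Pow S. \<Sum>w | w \<in> ?W \<and> set w - J = T. prod_list (map z w))"
    unfolding support_sum_def words_over_def by (intro sum.cong) auto
  also have "\<dots> = (\<Sum>w\<in>?W. prod_list (map z w))"
    by (rule sum.group) (use assms in \<open>auto intro: finite_lists_length_eq\<close>)
  finally show ?thesis
    using power_sum_eq_sum_words[of "J \<union> S" z n] assms by simp
qed

text \<open>Moebius inversion over the subsets of \<open>S\<close>. For \<open>z\<close> constant on
  \<open>S\<close> and \<open>S\<close> disjoint from \<open>J\<close>, this is a finite difference
  of order \<open>card S\<close> of the \<open>n\<close>-th power.\<close>

lemma support_sum_eq_alternating: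
  fixes z :: "'i \<Rightarrow> 'r::ring_1"
  assumes "finite J" "finite S"
  shows "support_sum n z J S =
    (\<Sum>T\<in>Pow S. (-1) ^ (card S - card T) * (\<Sum>i\<in>J \<union> T. z i) ^ n)"
  by (rule inclusion_exclusion_mobius) (use assms power_sum_eq_support_sums in auto)

section \<open>Surjective words and modified symmetrizations\<close>

lemma support_sum_reindex:
  assumes "distinct ts"
  shows "support_sum n z {} (set ts) =
    support_sum n (\<lambda>i. z (ts ! i)) {} {..<length ts}"
proof -
  let ?W = "words_over n {} {..<length ts}"
  have inj: "inj_on ((!) ts) {..<length ts}"
    by (rule inj_on_nth[OF assms]) simp
  have set_ts: "set ts = (!) ts ` {..<length ts}"
    by (auto simp: set_conv_nth)
  have "words_over n {} (set ts) = map ((!) ts) ` ?W"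
  proof (intro equalityI subsetI)
    fix w assume "w \<in> words_over n {} (set ts)"
    then have w: "length w = n" "set w = (!) ts ` {..<length ts}"
      by (simp_all add: words_over_def set_ts)
    let ?v = "map (the_inv_into {..<length ts} ((!) ts)) w"
    have "set ?v = {..<length ts}"
      using w(2) inj by (simp add: the_inv_into_f_f image_image)
    moreover have "map ((!) ts) ?v = w"
      unfolding map_map using w(2) inj by (intro map_idI) (auto simp: the_inv_into_f_f)
    moreover have "length ?v = n" using w(1) by simp
    ultimately have "?v \<in> ?W" by (simp only: words_over_def mem_Collect_eq Diff_empty simp_thms)
    then show "w \<in> map ((!) ts) ` ?W"
      using \<open>map ((!) ts) ?v = w\<close> by (metis imageI)
  next
    fix w assume "w \<in> map ((!) ts) ` ?W"
    then show "w \<in> words_over n {} (set ts)"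
      unfolding words_over_def set_ts by clarsimp
  qed
  moreover have "inj_on (map ((!) ts)) ?W"
  proof (rule inj_onI)
    fix u v assume "u \<in> ?W" "v \<in> ?W" "map ((!) ts) u = map ((!) ts) v"
    then show "u = v"
      using inj by (intro map_inj_on[of "(!) ts" u v]) (simp_all add: words_over_def)
  qed
  ultimately show ?thesis
    by (simp add: support_sum_def sum.reindex comp_def)
qed

lemma count_sum_replicate_mset:
  fixes s :: nat
  shows "count (\<Sum>r<s. replicate_mset (f r) r) i = (if i < s then f i else 0)"
  by (simp add: count_sum)

text \<open>Words are over the positions of \<open>ys\<close>, as in \<open>sym_poly\<close>, so
  equal entries of \<open>ys\<close> remain different letters. Grouping by the multiplicity vector
  \<open>?c w\<close> turns surjectivity into positivity of the parts.\<close>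

lemma sum_compositions_sym_tensor:
  "(\<Sum>ks\<in>compositions (length ys) n. sym_tensor ys ks) =
    support_sum n (\<lambda>i. tensor_in (ys ! i)) {} {..<length ys}"
proof -
  define s where "s = length ys"
  let ?W = "words_over n {} {..<s}"
  let ?c = "\<lambda>w. map (\<lambda>i. count (mset w) i) [0..<s]"
  let ?h = "\<lambda>w. prod_list (map (\<lambda>i. tensor_in (ys ! i)) w)"
  have fin: "finite ?W"
    by (rule finite_subset[OF _ finite_lists_length_eq[of "{..<s}" n]]) (auto simp: words_over_def)
  have c_in: "?c ` ?W \<subseteq> compositions s n"
  proof (clarify)
    fix w assume w: "w \<in> ?W"
    then have "sum_list (?c w) = (\<Sum>i\<in>set_mset (mset w). count (mset w) i)"
      by (simp add: words_over_def interv_sum_list_conv_sum_set_nat atLeast0LessThan)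
    also have "\<dots> = n"
      using w size_mset[of w] by (simp add: words_over_def size_multiset_overloaded_eq)
    finally show "?c w \<in> compositions s n"
      using w by (auto simp: compositions_def words_over_def)
  qed
  have fibre: "permutations_of_multiset (\<Sum>r<length ks. replicate_mset (ks ! r) r) =
      {w \<in> ?W. ?c w = ks}" if ks: "ks \<in> compositions s n" for ks
  proof -
    have len: "length ks = s" and pos: "\<And>i. i < s \<Longrightarrow> 0 < ks ! i" and sum: "sum_list ks = n"
      using ks by (auto simp: compositions_def)
    have mset_iff: "mset w = (\<Sum>r<length ks. replicate_mset (ks ! r) r) \<longleftrightarrow>
        (\<forall>i. count (mset w) i = (if i < s then ks ! i else 0))" for w
      by (simp only: multiset_eq_iff count_sum_replicate_mset len)
    have c_iff: "?c w = ks \<longleftrightarrow> (\<forall>i<s. count (mset w) i = ks ! i)" for w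
      by (auto simp: list_eq_iff_nth_eq len)
    show ?thesis
    proof (intro equalityI subsetI)
      fix w assume "w \<in> permutations_of_multiset (\<Sum>r<length ks. replicate_mset (ks ! r) r)"
      then have w: "mset w = (\<Sum>r<length ks. replicate_mset (ks ! r) r)"
        by (rule permutations_of_multisetD)
      have "size (mset w) = sum_list ks"
        unfolding w by (simp add: size_multiset_sum sum_list_sum_nth atLeast0LessThan)
      then have "length w = n" using sum by simp
      have cnt: "count (mset w) i = (if i < s then ks ! i else 0)" for i
        using w mset_iff by blast
      have "i \<in> set w \<longleftrightarrow> i < s" for i
        unfolding set_mset_mset[symmetric] count_greater_zero_iff[symmetric] cnt
        using pos by simp
      then have "set w = {..<s}" by auto
      then show "w \<in> {w \<in> ?W. ?c w = ks}"
        using \<open>length w = n\<close> cnt c_iff by (simp add: words_over_def)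
    next
      fix w assume "w \<in> {w \<in> ?W. ?c w = ks}"
      then have "set w = {..<s}" "?c w = ks" by (auto simp: words_over_def)
      then have "mset w = (\<Sum>r<length ks. replicate_mset (ks ! r) r)"
        unfolding mset_iff c_iff by (metis count_mset_0_iff lessThan_iff)
      then show "w \<in> permutations_of_multiset (\<Sum>r<length ks. replicate_mset (ks ! r) r)"
        by (rule permutations_of_multisetI)
    qed
  qed
  have "(\<Sum>ks\<in>compositions s n. sym_tensor ys ks) =
      (\<Sum>ks\<in>compositions s n. \<Sum>w | w \<in> ?W \<and> ?c w = ks. ?h w)"
    by (rule sum.cong) (simp_all add: sym_tensor_eq fibre pure_tensor_def comp_def)
  also have "\<dots> = (\<Sum>w\<in>?W. ?h w)"
    by (rule sum.group) (use fin c_in finite_compositions in auto)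
  finally show ?thesis by (simp add: s_def support_sum_def)
qed

section \<open>Powers and generators in each other's span\<close>

interpretation tensor_in: Modules.additive tensor_in
  by standard (rule tensor_in_add)

lemma span_signed:
  fixes t :: "'r::ring_1"
  assumes "t \<in> zmod.span B"
  shows "(-1) ^ k * t \<in> zmod.span B"
  using zmod.span_scale[OF assms, of "(-1) ^ k"] by (simp add: zscale_conv_mult)

text \<open>Inversion leaves signed \<open>n\<close>-th powers of partial sums, and additivity of
  \<open>tensor_in\<close> makes each base the image of a single module element.\<close>

lemma support_sum_in_power_submodule:
  assumes "finite S"
  shows "support_sum n (\<lambda>i. tensor_in (y i)) {} S \<in> power_submodule n"
  unfolding support_sum_eq_alternating[OF finite.emptyI assms] power_submodule_def
    tensor_in.sum[symmetric]
  by (intro zmod.span_sum span_signed zmod.span_base) blast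

definition onto_generators :: "(nat \<Rightarrow> 'a::ab_group_add) \<Rightarrow> nat \<Rightarrow> nat \<Rightarrow> 'a tensor_algebra set" where
  "onto_generators x m n = {(\<Sum>ks\<in>compositions s n. sym_tensor (map x js) ks) | s js.
      1 \<le> s \<and> s \<le> n \<and> length js = s \<and> sorted js \<and> set js \<subseteq> {1..m}}"

lemma power_sum_list_in_span_generators:
  assumes "0 < n" and p: "set p \<subseteq> {1..m}"
  shows "tensor_in (\<Sum>i\<leftarrow>p. x i) ^ n \<in> zmod.span (onto_generators x m n)"
proof -
  \<comment> \<open>Increasing positions in a sorted list pick out sorted indices, as the generators
    require.\<close>
  define q where "q = sort p"
  have q: "sorted q" "set q \<subseteq> {1..m}" using p by (auto simp: q_def)
  let ?z = "\<lambda>i. tensor_in (x (q ! i))"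
  have "(\<Sum>i\<leftarrow>p. x i) = (\<Sum>i\<leftarrow>q. x i)"
    unfolding q_def by (metis mset_map mset_sort sum_mset_sum_list)
  then have "tensor_in (\<Sum>i\<leftarrow>p. x i) = (\<Sum>i\<in>{} \<union> {..<length q}. ?z i)"
    by (simp add: sum_list_sum_nth atLeast0LessThan tensor_in.sum)
  then have "tensor_in (\<Sum>i\<leftarrow>p. x i) ^ n = (\<Sum>T\<in>Pow {..<length q}. support_sum n ?z {} T)"
    by (simp only: power_sum_eq_support_sums finite.emptyI finite_lessThan)
  also have "\<dots> \<in> zmod.span (onto_generators x m n)"
  proof (rule zmod.span_sum)
    fix T assume "T \<in> Pow {..<length q}"
    then have T: "T \<subseteq> {..<length q}" "finite T" by (auto intro: finite_subset)
    show "support_sum n ?z {} T \<in> zmod.span (onto_generators x m n)"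
    \<comment> \<open>Only supports with \<open>1 \<le> card T\<close> and
      \<open>card T \<le> n\<close> correspond to generators; the other sums vanish.\<close>
    proof (cases "T = {} \<or> n < card T")
      case True
      then show ?thesis
        using assms(1) by (auto simp: support_sum_empty_eq_0 support_sum_eq_0 zmod.span_zero)
    next
      case False
      define ts where "ts = sorted_list_of_set T"
      define js where "js = map ((!) q) ts"
      have ts: "set ts = T" "sorted ts" "distinct ts" "length ts = card T"
        using T by (simp_all add: ts_def)
      have "1 \<le> length js" "length js \<le> n"
        using False T ts by (auto simp: js_def Suc_le_eq card_gt_0_iff)
      moreover have "set js \<subseteq> {1..m}"
        using T(1) q(2) ts(1) by (auto simp: js_def subset_iff)
      moreover have "sorted js"
        unfolding js_def sorted_map
        by (rule sorted_wrt_mono_rel[OF _ ts(2)]) (use T(1) q(1) ts(1) in \<open>auto intro: sorted_nth_mono\<close>)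
      moreover have "support_sum n ?z {} T =
          (\<Sum>ks\<in>compositions (length js) n. sym_tensor (map x js) ks)"
      proof -
        have "support_sum n ?z {} T = support_sum n (\<lambda>i. ?z (ts ! i)) {} {..<length ts}"
          using support_sum_reindex[OF ts(3)] by (simp add: ts(1))
        also have "\<dots> = support_sum n (\<lambda>i. tensor_in (map x js ! i)) {} {..<length ts}"
          unfolding support_sum_def
          by (intro sum.cong refl arg_cong[of _ _ prod_list] map_cong)
             (auto simp: words_over_def js_def)
        finally show ?thesis
          using sum_compositions_sym_tensor[of "map x js" n] by (simp add: js_def)
      qed
      ultimately show ?thesis
        unfolding onto_generators_def by (intro zmod.span_base) blast
    qed
  qed
  finally show ?thesis .
qed

text \<open>Letter 0 carries \<open>y\<close> and each of \<open>n + 1\<close> further letters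
  carries \<open>a\<close>, so the support sum vanishes. In its alternating form the subset
  \<open>T\<close> contributes the power at \<open>y\<close> plus \<open>card T\<close> copies of
  \<open>a\<close>; the term for \<open>T = {}\<close> is \<open>tensor_in y ^ n\<close> up to sign
  and can be solved for without division.\<close>

lemma power_in_span_from_translates:
  assumes "\<And>k :: nat. 1 \<le> k \<Longrightarrow> tensor_in (y + (\<Sum>i<k. a)) ^ n \<in> zmod.span B"
  shows "tensor_in y ^ n \<in> zmod.span B"
proof -
  let ?S = "{1..Suc n}"
  let ?z = "\<lambda>i :: nat. tensor_in (if i = 0 then y else a)"
  let ?t = "\<lambda>T :: nat set. (-1) ^ (card ?S - card T) * (\<Sum>i\<in>{0} \<union> T. ?z i) ^ n"
  have sum_eq: "(\<Sum>i\<in>{0} \<union> T. ?z i) = tensor_in (y + (\<Sum>i<card T. a))" if "T \<in> Pow ?S" for T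
  proof -
    have "finite T" "0 \<notin> T" using that by (auto intro: finite_subset)
    moreover have "(\<Sum>i\<in>T. ?z i) = (\<Sum>i<card T. tensor_in a)"
    proof -
      have "(\<Sum>i\<in>T. ?z i) = (\<Sum>i\<in>T. tensor_in a)"
        using \<open>0 \<notin> T\<close> by (intro sum.cong) auto
      then show ?thesis by simp
    qed
    ultimately show ?thesis
      by (simp add: tensor_in.add tensor_in.sum del: sum_constant)
  qed
  have "0 = (\<Sum>T\<in>Pow ?S. ?t T)"
    using support_sum_eq_alternating[of "{0}" ?S n ?z] support_sum_eq_0[of "{0}" n ?S ?z] by simp
  also have "\<dots> = ?t {} + (\<Sum>T\<in>Pow ?S - {{}}. ?t T)"
    by (rule sum.remove) auto
  finally have "?t {} = - (\<Sum>T\<in>Pow ?S - {{}}. ?t T)"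
    by (simp add: eq_neg_iff_add_eq_0)
  also have "\<dots> \<in> zmod.span B"
  proof (intro zmod.span_neg zmod.span_sum span_signed)
    fix T assume T: "T \<in> Pow ?S - {{}}"
    then have "1 \<le> card T" by (auto simp: Suc_le_eq card_gt_0_iff intro: finite_subset)
    then show "(\<Sum>i\<in>{0} \<union> T. ?z i) ^ n \<in> zmod.span B"
      using assms[of "card T"] sum_eq[of T] T by (simp only: Diff_iff)
  qed
  \<comment> \<open>The factor \<open>(-1) ^ Suc n\<close> cancels the sign in
    \<open>?t {}\<close>.\<close>
  finally have "(-1) ^ Suc n * ?t {} \<in> zmod.span B" by (rule span_signed)
  then show ?thesis by (simp flip: mult.assoc power_add)
qed

text \<open>Induction on the subtracted indices. Translating by \<open>k \<ge> 1\<close> copies of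
  \<open>x j\<close> cancels the head \<open>j\<close>; the other \<open>k - 1\<close> copies join
  \<open>p\<close>, which is therefore kept arbitrary.\<close>

lemma power_diff_sum_list_in_span_generators:
  assumes "0 < n" "set p \<subseteq> {1..m}" "set q \<subseteq> {1..m}"
  shows "tensor_in ((\<Sum>i\<leftarrow>p. x i) - (\<Sum>i\<leftarrow>q. x i)) ^ n \<in> zmod.span (onto_generators x m n)"
  using assms(2,3)
proof (induction q arbitrary: p)
  case Nil
  then show ?case using power_sum_list_in_span_generators[OF assms(1)] by simp
next
  case (Cons j q)
  show ?case
  proof (rule power_in_span_from_translates[where a = "x j"])
    fix k :: nat assume "1 \<le> k"
    then obtain l where k: "k = Suc l" by (cases k) auto
    have "(\<Sum>i\<leftarrow>replicate l j @ p. x i) = (\<Sum>i<l. x j) + (\<Sum>i\<leftarrow>p. x i)"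
      by (induction l) (simp_all add: add_ac del: sum_constant)
    then have "(\<Sum>i\<leftarrow>p. x i) - (\<Sum>i\<leftarrow>j # q. x i) + (\<Sum>i<k. x j) =
        (\<Sum>i\<leftarrow>replicate l j @ p. x i) - (\<Sum>i\<leftarrow>q. x i)"
      by (simp add: k algebra_simps del: sum_constant)
    moreover have "set (replicate l j @ p) \<subseteq> {1..m}" "set q \<subseteq> {1..m}"
      using Cons.prems by auto
    ultimately show "tensor_in ((\<Sum>i\<leftarrow>p. x i) - (\<Sum>i\<leftarrow>j # q. x i) + (\<Sum>i<k. x j)) ^ n
        \<in> zmod.span (onto_generators x m n)"
      using Cons.IH by (simp only:)
  qed
qed

text \<open>Coefficients become repetitions of indices, negative ones in \<open>q\<close>; this
  unary form lets the induction on \<open>q\<close> strip one negative unit at a time.\<close>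

lemma span_eq_diff_sum_lists:
  assumes "y \<in> zmod.span (x ` A)"
  obtains p q where "set p \<subseteq> A" "set q \<subseteq> A" "y = (\<Sum>i\<leftarrow>p. x i) - (\<Sum>i\<leftarrow>q. x i)"
proof -
  have "\<exists>p q. set p \<subseteq> A \<and> set q \<subseteq> A \<and> y = (\<Sum>i\<leftarrow>p. x i) - (\<Sum>i\<leftarrow>q. x i)"
    using assms
  proof (induction rule: zmod.span_induct_alt)
    case base
    show ?case by (intro exI[of _ "[]"]) simp
  next
    case (step c a y)
    then obtain j p q where j: "j \<in> A" "a = x j" and pq: "set p \<subseteq> A" "set q \<subseteq> A"
      "y = (\<Sum>i\<leftarrow>p. x i) - (\<Sum>i\<leftarrow>q. x i)" by blast
    have rep: "(\<Sum>i\<leftarrow>replicate l j. x i) = (\<Sum>i<l. x j)" for l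
      by (induction l) (simp_all add: add_ac del: sum_constant)
    show ?case
    proof (cases "0 \<le> c")
      case True
      then show ?thesis
        using j pq rep[of "nat c"]
        by (intro exI[of _ "replicate (nat c) j @ p"] exI[of _ q])
           (auto simp: zscale_def algebra_simps simp del: sum_constant)
    next
      case False
      then show ?thesis
        using j pq rep[of "nat (- c)"]
        by (intro exI[of _ p] exI[of _ "replicate (nat (- c)) j @ q"])
           (auto simp: zscale_def algebra_simps simp del: sum_constant)
    qed
  qed
  then show thesis using that by blast
qed

theorem theorem8:
  fixes x :: "nat \<Rightarrow> 'a::ab_group_add" and m n :: nat
  assumes "inj_on x {1..m}"
    and "zmod.independent (x ` {1..m})"
    and "zmod.span (x ` {1..m}) = UNIV"
    and "0 < n"
  shows "power_submodule n =
    zmod.span {(\<Sum>ks\<in>compositions s n. sym_tensor (map x js) ks) | s js.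
      1 \<le> s \<and> s \<le> n \<and> length js = s \<and> sorted js \<and> set js \<subseteq> {1..m}}"
  unfolding onto_generators_def[symmetric]
proof
  show "power_submodule n \<subseteq> zmod.span (onto_generators x m n)"
    unfolding power_submodule_def
  proof (rule zmod.span_minimal[OF _ zmod.subspace_span], clarify)
    fix y :: 'a
    have "y \<in> zmod.span (x ` {1..m})" using assms(3) by simp
    then obtain p q where "set p \<subseteq> {1..m}" "set q \<subseteq> {1..m}"
      "y = (\<Sum>i\<leftarrow>p. x i) - (\<Sum>i\<leftarrow>q. x i)" by (rule span_eq_diff_sum_lists)
    then show "tensor_in y ^ n \<in> zmod.span (onto_generators x m n)"
      using power_diff_sum_list_in_span_generators[OF assms(4)] by blast
  qed
  \<comment> \<open>Each generator is a support sum over the positions of its index list.\<close>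
  have "onto_generators x m n \<subseteq> power_submodule n"
  proof
    fix t assume "t \<in> onto_generators x m n"
    then obtain js where "t = (\<Sum>ks\<in>compositions (length js) n. sym_tensor (map x js) ks)"
      by (auto simp: onto_generators_def)
    then show "t \<in> power_submodule n"
      using sum_compositions_sym_tensor[of "map x js" n]
        support_sum_in_power_submodule[of "{..<length js}"] by simp
  qed
  then show "zmod.span (onto_generators x m n) \<subseteq> power_submodule n"
    by (intro zmod.span_minimal) (simp_all add: power_submodule_def zmod.subspace_span)
qed

end
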